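(* Let $n\ge 2$ be an integer, let $\alpha\in(0,1/(n-1))$, and let $f(x)=\frac12 x^TAx$ on $\mathbb{R}^n$ with Hessian matrix $A=(1+\alpha)I-\alpha\mathbf{1}\mathbf{1}^T$. Then the (expected) iteration matrices $B_{\mathrm{CCD}}$, $B_{\mathrm{RPCD}}$, $B_{\mathrm{RCD}}$ defined in the context satisfy $$\rho(B_{\mathrm{CCD}})<\rho(B_{\mathrm{RPCD}})<\rho(B_{\mathrm{RCD}})^n .$$
   Context: $\mathbf{1}\in\mathbb{R}^n$ is the all-ones vector and $\rho(\cdot)$ is the spectral radius. Write $A=I-N-N^T$, where $-N$ is the strictly lower triangular part of $A$ (the diagonal of $A$ is $I$). Define - $B_{\mathrm{CCD}}=(I-N)^{-1}N^T$, the iteration matrix of one epoch ($n$ iterations) of cyclic coordinate descent with exact line search on $f$; - $B_{\mathrm{RPCD}}=\mathbb{E}_P[P B_{\mathrm{CCD}}P^T]$, where $P$ is a uniformly random $n\times n$ permutation matrix (the expected one-epoch iteration matrix of random-permutations cyclic coordinate descent; here $P^TAP=A$ for every permutation matrix $P$); - $B_{\mathrm{RCD}}=I-\frac1n A$, the expected one-iteration matrix of coordinate descent with coordinates sampled uniformly with replacement. *)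

theory Defs
  imports
    "Jordan_Normal_Form.Spectral_Radius"
    "Jordan_Normal_Form.Gauss_Jordan_Elimination"
    "HOL-Combinatorics.Permutations"
begin

text \<open>
  Square real matrices of size \<open>n\<close> are elements of \<open>carrier_mat n n\<close>, with rows and columns
  indexed by \<open>0, \<dots>, n - 1\<close>. The spectral radius of a real matrix is taken over its complex
  eigenvalues.
\<close>

definition real_spectral_radius :: "real mat \<Rightarrow> real" where
  "real_spectral_radius M = spectral_radius (map_mat complex_of_real M)"

text \<open>The outer product of the all-ones vector with itself, the vector being an \<open>n \<times> 1\<close> matrix.\<close>

definition ones_col :: "nat \<Rightarrow> real mat" where
  "ones_col n = mat n 1 (\<lambda>_. 1)"

definition hess :: "nat \<Rightarrow> real \<Rightarrow> real mat" where
  "hess n \<alpha> = (1 + \<alpha>) \<cdot>\<^sub>m 1\<^sub>m n - \<alpha> \<cdot>\<^sub>m (ones_col n * (ones_col n)\<^sup>T)"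

text \<open>
  The matrix \<open>N\<close> of the splitting \<open>A = I - N - N\<^sup>T\<close> of a symmetric matrix \<open>A\<close> with unit diagonal:
  \<open>-N\<close> is the strictly lower triangular part of \<open>A\<close>.
\<close>

definition lower_N :: "real mat \<Rightarrow> real mat" where
  "lower_N A = mat (dim_row A) (dim_col A) (\<lambda>(i, j). if j < i then - A $$ (i, j) else 0)"

lemma unit_diag_splitting:
  assumes A: "A \<in> carrier_mat n n" and sym: "A\<^sup>T = A" and diag: "\<And>i. i < n \<Longrightarrow> A $$ (i, i) = 1"
  shows "A = 1\<^sub>m n - lower_N A - (lower_N A)\<^sup>T"
proof (rule eq_matI)
  fix i j
  assume "i < dim_row (1\<^sub>m n - lower_N A - (lower_N A)\<^sup>T)"
    and "j < dim_col (1\<^sub>m n - lower_N A - (lower_N A)\<^sup>T)"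
  then have ij: "i < n" "j < n"
    using A by (auto simp: lower_N_def)
  have "A $$ (i, j) = A\<^sup>T $$ (i, j)"
    using sym by simp
  also have "\<dots> = A $$ (j, i)"
    using A ij by auto
  finally show "A $$ (i, j) = (1\<^sub>m n - lower_N A - (lower_N A)\<^sup>T) $$ (i, j)"
    using A ij diag by (auto simp: lower_N_def)
qed (use A in \<open>auto simp: lower_N_def\<close>)

lemma hess_splitting:
  "hess n \<alpha> = 1\<^sub>m n - lower_N (hess n \<alpha>) - (lower_N (hess n \<alpha>))\<^sup>T"
  by (rule unit_diag_splitting)
    (auto simp: hess_def ones_col_def scalar_prod_def intro!: eq_matI)

text \<open>
  \<open>mat_inverse\<close> is option-valued; \<open>I - N\<close> is unit lower triangular and hence always invertible.
\<close>

lemma inverse_I_minus_lower_N: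
  assumes A: "A \<in> carrier_mat n n"
  obtains C where "mat_inverse (1\<^sub>m n - lower_N A) = Some C" "C \<in> carrier_mat n n"
    "(1\<^sub>m n - lower_N A) * C = 1\<^sub>m n" "C * (1\<^sub>m n - lower_N A) = 1\<^sub>m n"
proof -
  let ?L = "1\<^sub>m n - lower_N A"
  have L: "?L \<in> carrier_mat n n"
    using A by (auto simp: lower_N_def)
  have "det ?L = prod_list (diag_mat ?L)"
    by (rule det_lower_triangular[OF _ L]) (use A in \<open>auto simp: lower_N_def\<close>)
  also have "diag_mat ?L = map (\<lambda>_. 1) [0..<n]"
    using A by (auto simp: diag_mat_def lower_N_def)
  also have "prod_list \<dots> = (1 :: real)"
    by (induction n) auto
  finally have "?L \<in> Units (ring_mat TYPE(real) n ())"
    using det_non_zero_imp_unit[OF L] by simp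
  then obtain C where "mat_inverse ?L = Some C"
    using mat_inverse(1)[OF L, of "()"] by (cases "mat_inverse ?L") auto
  then show ?thesis
    using that mat_inverse(2)[OF L] by blast
qed

definition B_CCD :: "real mat \<Rightarrow> real mat" where
  "B_CCD A = the (mat_inverse (1\<^sub>m (dim_row A) - lower_N A)) * (lower_N A)\<^sup>T"

definition permutation_matrices :: "nat \<Rightarrow> real mat set" where
  "permutation_matrices n =
    {mat n n (\<lambda>(i, j). if p j = i then 1 else 0) | p. p permutes {0..<n}}"

text \<open>
  The expectation over a uniformly random permutation matrix is the (entrywise) average over the
  finite set of all \<open>n \<times> n\<close> permutation matrices.
\<close>

definition B_RPCD :: "real mat \<Rightarrow> real mat" where
  "B_RPCD A = mat (dim_row A) (dim_row A) (\<lambda>(i, j).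
    (\<Sum>P\<in>permutation_matrices (dim_row A). (P * B_CCD A * P\<^sup>T) $$ (i, j))
      / real (card (permutation_matrices (dim_row A))))"

lemma finite_permutation_matrices: "finite (permutation_matrices n)"
  unfolding permutation_matrices_def
  using finite_permutations[of "{0..<n}"] by (auto simp: setcompr_eq_image)

lemma permutation_matrices_nonempty: "permutation_matrices n \<noteq> {}"
  unfolding permutation_matrices_def using permutes_id[of "{0..<n}"] by blast

definition B_RCD :: "real mat \<Rightarrow> real mat" where
  "B_RCD A = 1\<^sub>m (dim_row A) - (1 / real (dim_row A)) \<cdot>\<^sub>m A"

end

theory Submission
  imports Defs
begin

text \<open>
  All three iteration matrices are entrywise nonnegative, and two of them have constant row sums;
  the spectral radius of such a matrix is that row sum, so only \<open>B\<^sub>C\<^sub>C\<^sub>D\<close> needs a genuine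
  Perron-Frobenius argument.

  Write \<open>B\<close> for \<open>B\<^sub>C\<^sub>C\<^sub>D\<close> and \<open>R\<^sub>i\<close> for the sum of its row \<open>i\<close>. Solving \<open>(I - N) B = N\<^sup>T\<close> by forward
  substitution shows \<open>B \<ge> 0\<close> and \<open>R\<^sub>i = 1 - (1 - (n - 1) \<alpha>) (1 + \<alpha>)\<^sup>i\<close>, which strictly decreases
  in \<open>i\<close> (\<open>ccd_row_sum\<close>). Conjugating \<open>B\<close> by a uniformly random permutation averages the row sums,
  so \<open>\<rho>(B\<^sub>R\<^sub>P\<^sub>C\<^sub>D)\<close> is the mean of the \<open>R\<^sub>i\<close> (\<open>real_spectral_radius_B_RPCD\<close>).

  The first inequality says that \<open>\<rho>(B)\<close> is less than the mean row sum. Let \<open>r\<close> in \<open>(0, 1)\<close> solve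
  \<open>r\<^sup>n\<^sup>-\<^sup>1 = \<alpha> (1 + r + \<dots> + r\<^sup>n\<^sup>-\<^sup>2)\<close>. Then \<open>w\<^sub>j = \<Sum>k<j. r\<^sup>n\<^sup>-\<^sup>1\<^sup>-\<^sup>k\<close> is a nonnegative left
  eigenvector of \<open>B\<close> for the eigenvalue \<open>r\<^sup>n\<close> (\<open>ccd_left_eigenvector\<close>). Pairing \<open>w\<close> with the moduli
  of any complex eigenvector gives \<open>\<rho>(B) \<le> r\<^sup>n\<close>, and pairing \<open>w\<close> with the all-ones vector gives
  \<open>r\<^sup>n \<Sum>w\<^sub>i = \<Sum>w\<^sub>i R\<^sub>i\<close>. As \<open>w\<close> increases while \<open>R\<close> decreases, Chebyshev's sum inequality bounds the
  right-hand side strictly by \<open>\<Sum>w\<^sub>i\<close> times the mean of \<open>R\<close>.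

  For the second inequality, \<open>\<rho>(B\<^sub>R\<^sub>C\<^sub>D)\<close> is the row sum \<open>u = 1 - (1 - (n - 1) \<alpha>) / n\<close>, and the mean
  of the \<open>R\<^sub>i\<close> equals \<open>1 - (1 - u) \<Sum>i<n. (1 + \<alpha>)\<^sup>i\<close>. Since \<open>u < 1 < 1 + \<alpha>\<close>, replacing \<open>1 + \<alpha>\<close> by \<open>u\<close>
  increases this strictly, and the geometric sum then collapses to \<open>u\<^sup>n\<close>.
\<close>

section \<open>Spectral radii of nonnegative matrices\<close>

text \<open>
  Taking moduli in \<open>M v = \<lambda> v\<close> turns a complex eigenvector into a nonnegative vector \<open>x\<close> with
  \<open>\<bar>\<lambda>\<bar> x \<le> M x\<close>. So every upper bound on the real factors \<open>l\<close> with \<open>l x \<le> M x\<close> bounds the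
  spectral radius, and the complex numbers disappear from the rest of the argument.
\<close>

lemma real_spectral_radius_le_by_subinvariance:
  fixes M :: "real mat"
  assumes M: "M \<in> carrier_mat n n" and "n > 0"
    and nonneg: "\<And>i j. i < n \<Longrightarrow> j < n \<Longrightarrow> 0 \<le> M $$ (i, j)"
    and bound: "\<And>l x. \<lbrakk>0 \<le> l; \<And>i. i < n \<Longrightarrow> 0 \<le> x i; \<exists>i<n. 0 < x i;
        \<And>i. i < n \<Longrightarrow> l * x i \<le> (\<Sum>j<n. M $$ (i, j) * x j)\<rbrakk> \<Longrightarrow> l \<le> c"
  shows "real_spectral_radius M \<le> c"
proof -
  let ?M = "map_mat complex_of_real M"
  have cM: "?M \<in> carrier_mat n n"
    using M by simp
  obtain l v where rho: "real_spectral_radius M = norm l" and ev: "eigenvector ?M v l"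
    using spectral_radius_mem_max(1)[OF cM \<open>n > 0\<close>]
    by (auto simp: real_spectral_radius_def spectrum_def eigenvalue_def)
  have v: "v \<in> carrier_vec n" "v \<noteq> 0\<^sub>v n" "?M *\<^sub>v v = l \<cdot>\<^sub>v v"
    using ev M by (auto simp: eigenvector_def)
  have "norm l \<le> c"
  proof (rule bound)
    show "\<exists>i<n. 0 < norm (v $ i)"
      using v by (metis eq_vecI carrier_vecD index_zero_vec zero_less_norm_iff)
    fix i assume i: "i < n"
    have "l * v $ i = (l \<cdot>\<^sub>v v) $ i"
      using v i by simp
    also have "\<dots> = (\<Sum>j<n. complex_of_real (M $$ (i, j)) * v $ j)"
      using v i M unfolding v(3)[symmetric]
      by (auto simp: scalar_prod_def lessThan_atLeast0)
    finally have "norm l * norm (v $ i) = norm (\<Sum>j<n. complex_of_real (M $$ (i, j)) * v $ j)"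
      by (metis norm_mult)
    also have "\<dots> \<le> (\<Sum>j<n. norm (complex_of_real (M $$ (i, j)) * v $ j))"
      by (rule norm_sum)
    also have "\<dots> = (\<Sum>j<n. M $$ (i, j) * norm (v $ j))"
      by (intro sum.cong) (auto simp: norm_mult nonneg i)
    finally show "norm l * norm (v $ i) \<le> (\<Sum>j<n. M $$ (i, j) * norm (v $ j))" .
  qed auto
  then show ?thesis
    using rho by simp
qed

text \<open>
  The all-ones vector is an eigenvector for the row sum; conversely, comparing
  \<open>l x \<le> M x\<close> at a position where \<open>x\<close> is largest shows that no larger \<open>l\<close> is possible.
\<close>

lemma real_spectral_radius_const_row_sums:
  fixes M :: "real mat"
  assumes M: "M \<in> carrier_mat n n" and n: "n > 0"
    and nonneg: "\<And>i j. i < n \<Longrightarrow> j < n \<Longrightarrow> 0 \<le> M $$ (i, j)"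
    and rows: "\<And>i. i < n \<Longrightarrow> (\<Sum>j<n. M $$ (i, j)) = g"
  shows "real_spectral_radius M = g"
proof (rule antisym)
  show "real_spectral_radius M \<le> g"
  proof (rule real_spectral_radius_le_by_subinvariance[OF M n nonneg])
    fix l :: real and x :: "nat \<Rightarrow> real"
    assume x0: "\<And>i. i < n \<Longrightarrow> 0 \<le> x i" and ex: "\<exists>i<n. 0 < x i"
      and sub: "\<And>i. i < n \<Longrightarrow> l * x i \<le> (\<Sum>j<n. M $$ (i, j) * x j)"
    define m where "m = Max (x ` {..<n})"
    have le: "x j \<le> m" if "j < n" for j
      using that by (auto simp: m_def)
    have "m \<in> x ` {..<n}"
      unfolding m_def by (rule Max_in) (use n in auto)
    then obtain i where i: "i < n" "x i = m"
      by auto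
    have "m > 0"
      using ex le by (meson less_le_trans)
    have "l * m \<le> (\<Sum>j<n. M $$ (i, j) * x j)"
      using sub[OF i(1)] i by simp
    also have "\<dots> \<le> (\<Sum>j<n. M $$ (i, j) * m)"
      by (intro sum_mono mult_left_mono) (auto simp: le nonneg i)
    also have "\<dots> = g * m"
      using rows[OF i(1)] by (simp add: sum_distrib_right[symmetric])
    finally show "l \<le> g"
      using \<open>m > 0\<close> by simp
  qed
next
  let ?M = "map_mat complex_of_real M"
  let ?v = "vec n (\<lambda>_. 1 :: complex)"
  have cM: "?M \<in> carrier_mat n n"
    using M by simp
  have "?M *\<^sub>v ?v = complex_of_real g \<cdot>\<^sub>v ?v"
  proof (rule eq_vecI)
    fix i assume "i < dim_vec (complex_of_real g \<cdot>\<^sub>v ?v)"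
    then have i: "i < n"
      by simp
    then have "(?M *\<^sub>v ?v) $ i = (\<Sum>j<n. complex_of_real (M $$ (i, j)))"
      using M by (auto simp: scalar_prod_def lessThan_atLeast0)
    also have "\<dots> = complex_of_real g"
      using rows[OF i] by (metis of_real_sum)
    finally show "(?M *\<^sub>v ?v) $ i = (complex_of_real g \<cdot>\<^sub>v ?v) $ i"
      using i by simp
  qed (use M in auto)
  moreover have "?v \<noteq> 0\<^sub>v n"
    using n by (metis index_vec index_zero_vec(1) zero_neq_one)
  ultimately have "eigenvalue ?M (complex_of_real g)"
    using M by (auto simp: eigenvalue_def eigenvector_def intro!: exI[of _ ?v])
  then have "complex_of_real g \<in> spectrum ?M"
    by (simp add: spectrum_def)
  then have "norm (complex_of_real g) \<in> norm ` spectrum ?M"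
    by (rule imageI)
  from spectral_radius_mem_max(2)[OF cM n this]
  show "g \<le> real_spectral_radius M"
    by (simp add: real_spectral_radius_def)
qed

section \<open>The matrix of cyclic coordinate descent\<close>

lemma hess_carrier: "hess n \<alpha> \<in> carrier_mat n n"
  by (auto simp: hess_def ones_col_def)

lemma hess_entry:
  assumes "i < n" "j < n"
  shows "hess n \<alpha> $$ (i, j) = (if i = j then 1 else - \<alpha>)"
  using assms by (auto simp: hess_def ones_col_def scalar_prod_def)

text \<open>
  The recursion is row \<open>i\<close> of \<open>(I - N) B = N\<^sup>T\<close>. It determines \<open>B\<close> from the top row down, so the
  inverse of \<open>I - N\<close> never has to be computed.
\<close>

lemma B_CCD_recursion:
  fixes n \<alpha>
  defines "B \<equiv> B_CCD (hess n \<alpha>)"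
  shows "B \<in> carrier_mat n n"
    and "\<And>i j. i < n \<Longrightarrow> j < n \<Longrightarrow>
      B $$ (i, j) = \<alpha> * (\<Sum>k<i. B $$ (k, j)) + (if i < j then \<alpha> else 0)"
proof -
  let ?N = "lower_N (hess n \<alpha>)"
  have N: "?N \<in> carrier_mat n n"
    using hess_carrier[of n \<alpha>] by (auto simp: lower_N_def)
  have N_entry: "?N $$ (i, j) = (if j < i then \<alpha> else 0)" if "i < n" "j < n" for i j
    using that hess_carrier[of n \<alpha>] by (auto simp: lower_N_def hess_entry)
  obtain C where C: "mat_inverse (1\<^sub>m n - ?N) = Some C" "C \<in> carrier_mat n n"
    "(1\<^sub>m n - ?N) * C = 1\<^sub>m n"
    using inverse_I_minus_lower_N[OF hess_carrier] by metis
  have dim: "dim_row (hess n \<alpha>) = n"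
    using hess_carrier[of n \<alpha>] by auto
  have B: "B = C * ?N\<^sup>T"
    using C dim by (simp add: B_def B_CCD_def)
  show Bc: "B \<in> carrier_mat n n"
    using B C N by simp
  have L: "1\<^sub>m n - ?N \<in> carrier_mat n n"
    using N by (rule minus_carrier_mat)
  have eq: "(1\<^sub>m n - ?N) * B = ?N\<^sup>T"
    unfolding B using C N L by (simp add: assoc_mult_mat[symmetric, OF L C(2)])
  fix i j assume ij: "i < n" "j < n"
  have "(if i < j then \<alpha> else 0) = ((1\<^sub>m n - ?N) * B) $$ (i, j)"
    unfolding eq using ij N by (simp add: N_entry)
  also have "\<dots> = (\<Sum>k<n. (1\<^sub>m n - ?N) $$ (i, k) * B $$ (k, j))"
    using ij Bc N by (auto simp: scalar_prod_def lessThan_atLeast0)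
  also have "\<dots> = (\<Sum>k<n. (if k = i then B $$ (k, j) else 0)
      - (if k < i then \<alpha> * B $$ (k, j) else 0))"
    using ij N by (intro sum.cong) (auto simp: N_entry)
  also have "\<dots> = B $$ (i, j) - (\<Sum>k\<in>{..<n} \<inter> {k. k < i}. \<alpha> * B $$ (k, j))"
    using ij by (simp add: sum_subtractf sum.If_cases)
  also have "{..<n} \<inter> {k. k < i} = {..<i}"
    using ij by auto
  finally show "B $$ (i, j) = \<alpha> * (\<Sum>k<i. B $$ (k, j)) + (if i < j then \<alpha> else 0)"
    by (simp add: sum_distrib_left)
qed

lemma forward_substitution_nonneg:
  fixes b :: "nat \<Rightarrow> real"
  assumes "0 \<le> \<alpha>" and c: "\<And>i. i < n \<Longrightarrow> 0 \<le> c i"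
    and rec: "\<And>i. i < n \<Longrightarrow> b i = \<alpha> * (\<Sum>k<i. b k) + c i"
  shows "i < n \<Longrightarrow> 0 \<le> b i"
proof (induction i rule: less_induct)
  case (less i)
  have "0 \<le> (\<Sum>k<i. b k)"
    by (rule sum_nonneg) (use less in auto)
  then have "0 \<le> \<alpha> * (\<Sum>k<i. b k) + c i"
    using \<open>0 \<le> \<alpha>\<close> c[OF less.prems] by simp
  then show ?case
    by (simp only: rec[OF less.prems])
qed

lemma B_CCD_nonneg:
  assumes "0 \<le> \<alpha>" "i < n" "j < n"
  shows "0 \<le> B_CCD (hess n \<alpha>) $$ (i, j)"
proof (rule forward_substitution_nonneg[where b = "\<lambda>i. B_CCD (hess n \<alpha>) $$ (i, j)"
      and c = "\<lambda>i. if i < j then \<alpha> else 0", OF assms(1) _ _ assms(2)])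
  fix k assume "k < n"
  show "B_CCD (hess n \<alpha>) $$ (k, j)
      = \<alpha> * (\<Sum>l<k. B_CCD (hess n \<alpha>) $$ (l, j)) + (if k < j then \<alpha> else 0)"
    by (rule B_CCD_recursion(2)[OF \<open>k < n\<close> assms(3)])
qed (use assms in auto)

lemma forward_substitution_const:
  fixes b :: "nat \<Rightarrow> real"
  assumes rec: "\<And>i. i < n \<Longrightarrow> b i = \<alpha> * (\<Sum>k<i. b k) + c"
  shows "i < n \<Longrightarrow> b i = c * (1 + \<alpha>) ^ i"
proof (induction i)
  case 0
  then show ?case using rec[of 0] by simp
next
  case (Suc i)
  have "b (Suc i) = b i + \<alpha> * b i"
    using rec[of i] rec[of "Suc i"] Suc.prems by (simp add: algebra_simps)
  then show ?case
    using Suc by (simp add: algebra_simps)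
qed

text \<open>
  The defects \<open>d\<^sub>i = 1 - R\<^sub>i\<close> obey the same recursion with a right-hand side that does not depend on
  \<open>i\<close>: the row sums \<open>(n - 1 - i) \<alpha>\<close> of \<open>N\<^sup>T\<close> and \<open>i \<alpha>\<close> of \<open>N\<close> add up to \<open>(n - 1) \<alpha>\<close>.
\<close>

lemma ccd_row_sum:
  fixes b :: "nat \<Rightarrow> nat \<Rightarrow> real"
  assumes rec: "\<And>i j. i < n \<Longrightarrow> j < n \<Longrightarrow>
      b i j = \<alpha> * (\<Sum>k<i. b k j) + (if i < j then \<alpha> else 0)"
    and i: "i < n"
  shows "(\<Sum>j<n. b i j) = 1 - (1 - (real n - 1) * \<alpha>) * (1 + \<alpha>) ^ i"
proof -
  define d where "d i = 1 - (\<Sum>j<n. b i j)" for i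
  have "d i = \<alpha> * (\<Sum>k<i. d k) + (1 - (real n - 1) * \<alpha>)" if i: "i < n" for i
  proof -
    have "(\<Sum>j<n. b i j) = (\<Sum>j<n. \<alpha> * (\<Sum>k<i. b k j) + (if i < j then \<alpha> else 0))"
      using rec[OF i] by (intro sum.cong) auto
    also have "\<dots> = \<alpha> * (\<Sum>k<i. \<Sum>j<n. b k j) + (\<Sum>j\<in>{..<n} \<inter> {j. i < j}. \<alpha>)"
      by (simp add: sum.distrib sum_distrib_left[symmetric] sum.If_cases
          sum.swap[of _ "{..<i}" "{..<n}"])
    also have "{..<n} \<inter> {j. i < j} = {i<..<n}"
      by auto
    finally have "(\<Sum>j<n. b i j) = \<alpha> * (\<Sum>k<i. \<Sum>j<n. b k j) + real (n - Suc i) * \<alpha>"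
      by simp
    moreover have "real (n - Suc i) = real n - 1 - real i"
      using i by (simp add: of_nat_diff)
    ultimately show ?thesis
      by (simp add: d_def sum_subtractf algebra_simps)
  qed
  from forward_substitution_const[OF this i] show ?thesis
    by (simp add: d_def)
qed

text \<open>
  The equation for \<open>r\<close> comes from the eigenvector equation \<open>N\<^sup>T v = \<lambda> (I - N) v\<close>: subtracting
  consecutive rows forces \<open>v\<close> to be geometric with ratio \<open>r\<close>, the last row is the equation below,
  and then \<open>\<lambda> = r\<^sup>n\<close>. A root lies in \<open>(0, 1)\<close> because the two sides compare as \<open>0 < \<alpha>\<close> at \<open>r = 0\<close> and
  as \<open>1 > (n - 1) \<alpha>\<close> at \<open>r = 1\<close>.
\<close>

lemma ccd_perron_parameter:
  fixes \<alpha> :: real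
  assumes n: "n \<ge> 2" and \<alpha>: "0 < \<alpha>" "(real n - 1) * \<alpha> < 1"
  obtains r where "0 < r" "r < 1" "r ^ (n - 1) = \<alpha> * (\<Sum>j<n - 1. r ^ j)"
proof -
  define h where "h r = r ^ (n - 1) - \<alpha> * (\<Sum>j<n - 1. r ^ j)" for r :: real
  have "(\<Sum>j<n - 1. (0::real) ^ j) = 1"
    using n by (cases "n - 1") (auto simp: lessThan_Suc_eq_insert_0 sum.reindex)
  then have h0: "h 0 < 0"
    using n \<alpha> by (simp add: h_def power_0_left)
  have h1: "h 1 > 0"
    using n \<alpha> by (simp add: h_def of_nat_diff mult.commute)
  have "\<exists>r\<ge>0. r \<le> 1 \<and> h r = 0"
    by (rule IVT') (use h0 h1 in \<open>auto simp: h_def intro!: continuous_intros\<close>)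
  then obtain r where r: "0 \<le> r" "r \<le> 1" "h r = 0"
    by auto
  moreover have "r \<noteq> 0" "r \<noteq> 1"
    using r h0 h1 by auto
  ultimately show ?thesis
    using that[of r] by (auto simp: h_def)
qed

text \<open>
  With \<open>z\<^sub>i = r\<^sup>n\<^sup>-\<^sup>1\<^sup>-\<^sup>i\<close> this is \<open>r\<^sup>n (I - N\<^sup>T) z = N z\<close>, the eigenvector equation for the transposed
  splitting. Reversing the order of the coordinates exchanges \<open>N\<close> and \<open>N\<^sup>T\<close>, which is why the
  geometric vector appears here with its entries reversed. Row \<open>0\<close> is the equation for \<open>r\<close>; the
  difference of consecutive rows is its closed form \<open>r\<^sup>n\<^sup>-\<^sup>1 (1 + \<alpha> - r) = \<alpha>\<close>.
\<close>

lemma ccd_perron_vector: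
  fixes r \<alpha> :: real
  assumes root: "r ^ (n - 1) = \<alpha> * (\<Sum>j<n - 1. r ^ j)"
  shows "i < n \<Longrightarrow>
    r ^ n * (r ^ (n - 1 - i) - \<alpha> * (\<Sum>k\<in>{i<..<n}. r ^ (n - 1 - k)))
      = \<alpha> * (\<Sum>j<i. r ^ (n - 1 - j))"
proof (induction i)
  case 0
  have "(\<Sum>k\<in>{0<..<n}. r ^ (n - 1 - k)) = (\<Sum>j<n - 1. r ^ j)"
    by (rule sum.reindex_bij_witness[of _ "\<lambda>j. n - 1 - j" "\<lambda>k. n - 1 - k"]) auto
  then show ?case
    using root by simp
next
  case (Suc i)
  have "(1 - r) * r ^ (n - 1) = \<alpha> * ((1 - r) * (\<Sum>j<n - 1. r ^ j))"
    unfolding root by (simp only: mult_ac)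
  also have "\<dots> = \<alpha> * (1 - r ^ (n - 1))"
    by (simp only: one_diff_power_eq)
  finally have geom: "r ^ (n - 1) * (1 + \<alpha> - r) = \<alpha>"
    by (simp add: algebra_simps)
  have split: "{i<..<n} = insert (Suc i) {Suc i<..<n}"
    using Suc.prems by auto
  define m where "m = n - 1 - Suc i"
  have m: "n - 1 - i = Suc m" "n - 1 - Suc i = m"
    using Suc.prems by (auto simp: m_def)
  have tail: "(\<Sum>k\<in>{i<..<n}. r ^ (n - 1 - k)) = r ^ m + (\<Sum>k\<in>{Suc i<..<n}. r ^ (n - 1 - k))"
    unfolding split by (subst sum.insert) (auto simp: m_def)
  have rn: "r ^ n = r * r ^ (n - 1)"
    using Suc.prems by (cases n) auto
  have IH: "r ^ n * (r * r ^ m - \<alpha> * (r ^ m + (\<Sum>k\<in>{Suc i<..<n}. r ^ (n - 1 - k))))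
      = \<alpha> * (\<Sum>j<i. r ^ (n - 1 - j))"
    using Suc.IH[OF Suc_lessD[OF Suc.prems]] unfolding tail m(1) power_Suc .
  have "r ^ n * (r ^ m - \<alpha> * (\<Sum>k\<in>{Suc i<..<n}. r ^ (n - 1 - k)))
      = r ^ n * (r * r ^ m - \<alpha> * (r ^ m + (\<Sum>k\<in>{Suc i<..<n}. r ^ (n - 1 - k))))
        + r ^ Suc m * (r ^ (n - 1) * (1 + \<alpha> - r))"
    by (simp add: rn algebra_simps)
  also have "\<dots> = \<alpha> * (\<Sum>j<Suc i. r ^ (n - 1 - j))"
    unfolding IH geom m(1)[symmetric] by (simp add: algebra_simps)
  finally show ?case
    by (simp only: m)
qed

text \<open>
  By the previous lemma the vector \<open>\<alpha> w = N z\<close> equals \<open>r\<^sup>n (I - N\<^sup>T) z\<close>, hence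
  \<open>\<alpha> w\<^sup>T B = r\<^sup>n z\<^sup>T (I - N) B = r\<^sup>n z\<^sup>T N\<^sup>T = r\<^sup>n \<alpha> w\<^sup>T\<close>. The proof is this computation in coordinates;
  moving \<open>I - N\<close> from \<open>z\<close> to \<open>B\<close> is an exchange of two summations.
\<close>

lemma ccd_left_eigenvector:
  fixes b :: "nat \<Rightarrow> nat \<Rightarrow> real"
  assumes rec: "\<And>i j. i < n \<Longrightarrow> j < n \<Longrightarrow>
      b i j = \<alpha> * (\<Sum>k<i. b k j) + (if i < j then \<alpha> else 0)"
    and root: "r ^ (n - 1) = \<alpha> * (\<Sum>j<n - 1. r ^ j)"
    and \<alpha>: "\<alpha> \<noteq> 0" and j: "j < n"
  shows "(\<Sum>i<n. (\<Sum>k<i. r ^ (n - 1 - k)) * b i j) = r ^ n * (\<Sum>k<j. r ^ (n - 1 - k))"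
proof -
  define z where "z i = r ^ (n - 1 - i)" for i
  define w where "w i = (\<Sum>k<i. z k)" for i
  define tail where "tail i = (\<Sum>k\<in>{i<..<n}. z k)" for i
  define col where "col i = (\<Sum>k<i. b k j)" for i
  have w: "\<alpha> * w i = r ^ n * (z i - \<alpha> * tail i)" if "i < n" for i
    unfolding w_def tail_def z_def ccd_perron_vector[OF root that] ..
  have swap: "(\<Sum>i<n. tail i * b i j) = (\<Sum>k<n. z k * col k)"
  proof -
    have "(\<Sum>i<n. tail i * b i j) = (\<Sum>i<n. \<Sum>k\<in>{i<..<n}. z k * b i j)"
      by (simp add: tail_def sum_distrib_right)
    also have "\<dots> = (\<Sum>k<n. \<Sum>i<k. z k * b i j)"
      unfolding sum.Sigma[OF finite_lessThan ballI[OF finite_greaterThanLessThan]]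
        sum.Sigma[OF finite_lessThan ballI[OF finite_lessThan]]
      by (rule sum.reindex_bij_witness[of _ prod.swap prod.swap]) auto
    also have "\<dots> = (\<Sum>k<n. z k * col k)"
      by (simp add: col_def sum_distrib_left)
    finally show ?thesis .
  qed
  have "\<alpha> * (\<Sum>i<n. w i * b i j) = (\<Sum>i<n. (\<alpha> * w i) * b i j)"
    by (simp add: sum_distrib_left mult.assoc)
  also have "\<dots> = (\<Sum>i<n. r ^ n * (z i * b i j - \<alpha> * (tail i * b i j)))"
    by (intro sum.cong refl) (simp add: w algebra_simps)
  also have "\<dots> = r ^ n * ((\<Sum>i<n. z i * b i j) - \<alpha> * (\<Sum>i<n. tail i * b i j))"
    by (simp only: sum_subtractf flip: sum_distrib_left)
  also have "\<dots> = r ^ n * (\<Sum>i<n. z i * b i j - \<alpha> * (z i * col i))"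
    unfolding swap by (simp only: sum_subtractf sum_distrib_left)
  also have "(\<Sum>i<n. z i * b i j - \<alpha> * (z i * col i)) = (\<Sum>i<n. if i < j then \<alpha> * z i else 0)"
  proof (intro sum.cong refl)
    fix i assume "i \<in> {..<n}"
    then have "b i j = \<alpha> * col i + (if i < j then \<alpha> else 0)"
      using rec[of i j] j by (simp add: col_def)
    then show "z i * b i j - \<alpha> * (z i * col i) = (if i < j then \<alpha> * z i else 0)"
      by (simp add: algebra_simps)
  qed
  also have "\<dots> = (\<Sum>i\<in>{..<n} \<inter> {i. i < j}. \<alpha> * z i)"
    by (simp add: sum.If_cases)
  also have "{..<n} \<inter> {i. i < j} = {..<j}"
    using j by auto
  also have "r ^ n * (\<Sum>i<j. \<alpha> * z i) = \<alpha> * (r ^ n * w j)"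
    by (simp add: w_def flip: sum_distrib_left)
  finally have "(\<Sum>i<n. w i * b i j) = r ^ n * w j"
    using \<alpha> by simp
  then show ?thesis
    by (simp add: w_def z_def)
qed

text \<open>
  The difference of the two sides is half of \<open>\<Sum>i. \<Sum>j. (u\<^sub>i - u\<^sub>j) (v\<^sub>i - v\<^sub>j)\<close>, in which every
  off-diagonal term is negative.
\<close>

lemma Chebyshev_sum_strict:
  fixes u v :: "nat \<Rightarrow> real"
  assumes n: "n \<ge> 2"
    and u: "\<And>i j. i < j \<Longrightarrow> j < n \<Longrightarrow> u i < u j"
    and v: "\<And>i j. i < j \<Longrightarrow> j < n \<Longrightarrow> v j < v i"
  shows "real n * (\<Sum>i<n. u i * v i) < (\<Sum>i<n. u i) * (\<Sum>i<n. v i)"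
proof -
  have neg: "(u i - u j) * (v i - v j) < 0" if "i \<noteq> j" "i < n" "j < n" for i j
    using that u[of i j] v[of i j] u[of j i] v[of j i]
    by (cases "i < j") (auto simp: mult_less_0_iff)
  have le: "(u i - u j) * (v i - v j) \<le> 0" if "i < n" "j < n" for i j
    using neg[of i j] that by (cases "i = j") (auto intro: less_imp_le)
  have "(\<Sum>i<n. \<Sum>j<n. (u i - u j) * (v i - v j)) < (\<Sum>i<n. 0)"
  proof (rule sum_strict_mono_ex1)
    show "\<forall>i\<in>{..<n}. (\<Sum>j<n. (u i - u j) * (v i - v j)) \<le> 0"
      by (auto intro!: sum_nonpos le)
    have "(\<Sum>j<n. (u 0 - u j) * (v 0 - v j)) < (\<Sum>j<n. 0)"
      by (rule sum_strict_mono_ex1) (use n in \<open>auto intro!: le neg bexI[of _ 1]\<close>)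
    then show "\<exists>i\<in>{..<n}. (\<Sum>j<n. (u i - u j) * (v i - v j)) < 0"
      using n by (intro bexI[of _ 0]) auto
  qed simp
  also have "(\<Sum>i<n. \<Sum>j<n. (u i - u j) * (v i - v j))
      = 2 * (real n * (\<Sum>i<n. u i * v i)) - 2 * ((\<Sum>i<n. u i) * (\<Sum>i<n. v i))"
  proof -
    have expand: "(u i - u j) * (v i - v j)
        = (u i * v i + u j * v j) - (u i * v j + u j * v i)" for i j
      by (simp add: algebra_simps)
    have "(\<Sum>i<n. \<Sum>j<n. u i * v j) = (\<Sum>i<n. u i) * (\<Sum>i<n. v i)"
      by (simp only: sum_product)
    moreover have "(\<Sum>i<n. \<Sum>j<n. u j * v i) = (\<Sum>i<n. u i) * (\<Sum>i<n. v i)"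
      by (rule trans[OF sum.swap]) (simp only: sum_product)
    moreover have "(\<Sum>i<n. \<Sum>j<n. u i * v i) = real n * (\<Sum>i<n. u i * v i)"
      by (simp flip: sum_distrib_left)
    ultimately show ?thesis
      unfolding expand sum_subtractf sum.distrib by simp
  qed
  finally show ?thesis
    by simp
qed

lemma real_spectral_radius_B_CCD_less:
  fixes \<alpha> :: real
  assumes n: "n \<ge> 2" and \<alpha>: "0 < \<alpha>" "(real n - 1) * \<alpha> < 1"
  defines "B \<equiv> B_CCD (hess n \<alpha>)"
  shows "real_spectral_radius B < (\<Sum>i<n. \<Sum>j<n. B $$ (i, j)) / real n"
proof -
  note Bc = B_CCD_recursion(1)[of n \<alpha>, folded B_def]
  note rec = B_CCD_recursion(2)[of _ n _ \<alpha>, folded B_def]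
  have nonneg: "0 \<le> B $$ (i, j)" if "i < n" "j < n" for i j
    using B_CCD_nonneg that \<alpha> by (simp add: B_def)
  have col0: "B $$ (i, 0) = 0" if "i < n" for i
  proof -
    have "B $$ (i, 0) = \<alpha> * (\<Sum>k<i. B $$ (k, 0)) + 0" if "i < n" for i
      using rec[OF that, of 0] n by simp
    from forward_substitution_const[OF this that] show ?thesis
      by simp
  qed
  obtain r where r: "0 < r" "r < 1" "r ^ (n - 1) = \<alpha> * (\<Sum>j<n - 1. r ^ j)"
    using ccd_perron_parameter[OF n \<alpha>] by blast
  define w where "w i = (\<Sum>k<i. r ^ (n - 1 - k))" for i
  have left: "(\<Sum>i<n. w i * B $$ (i, j)) = r ^ n * w j" if "j < n" for j
    unfolding w_def
    by (rule ccd_left_eigenvector[where b = "\<lambda>i j. B $$ (i, j)", OF rec r(3) _ that]) (use \<alpha> in auto)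
  have w_mono: "w i < w j" if "i < j" for i j
    unfolding w_def
    by (rule sum_strict_mono2[where b = i]) (use that r in auto)
  have w0: "w 0 = 0"
    by (simp add: w_def)
  have w_nonneg: "0 \<le> w i" for i
    using w_mono[of 0 i] w0 by (cases "i = 0") auto
  have "real_spectral_radius B \<le> r ^ n"
  proof (rule real_spectral_radius_le_by_subinvariance[OF Bc _ nonneg])
    fix l :: real and x :: "nat \<Rightarrow> real"
    assume l: "0 \<le> l" and x0: "\<And>i. i < n \<Longrightarrow> 0 \<le> x i" and ex: "\<exists>i<n. 0 < x i"
      and sub: "\<And>i. i < n \<Longrightarrow> l * x i \<le> (\<Sum>j<n. B $$ (i, j) * x j)"
    show "l \<le> r ^ n"
    \<comment> \<open>The weight \<open>w 0\<close> vanishes, so pairing with \<open>w\<close> says nothing about an \<open>x\<close> supported at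
      index \<open>0\<close>; such an \<open>x\<close> is annihilated because column \<open>0\<close> of \<open>B\<close> is zero.\<close>
    proof (cases "\<exists>j<n. 0 < j \<and> 0 < x j")
      case False
      then have zero: "x j = 0" if "j < n" "0 < j" for j
        using that x0[of j] by force
      then have "0 < x 0"
        using ex by (metis less_irrefl gr0I)
      moreover have "(\<Sum>j<n. B $$ (0, j) * x j) = 0"
      proof (intro sum.neutral ballI)
        fix j assume "j \<in> {..<n}"
        then show "B $$ (0, j) * x j = 0"
          using n zero[of j] col0[of 0] by (cases "j = 0") auto
      qed
      ultimately have "l \<le> 0"
        using sub[of 0] n by (simp add: mult_le_0_iff)
      then show ?thesis
        using r by (meson less_imp_le order_trans zero_le_power)
    next
      case True
      then obtain j where j: "j < n" "0 < j" "0 < x j"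
        by blast
      have "0 < w j * x j"
        using w_mono[of 0 j] w0 j by simp
      then have pos: "0 < (\<Sum>i<n. w i * x i)"
        by (intro sum_pos2[of _ j]) (use j w_nonneg x0 in auto)
      have "l * (\<Sum>i<n. w i * x i) = (\<Sum>i<n. w i * (l * x i))"
        by (simp add: sum_distrib_left mult_ac)
      also have "\<dots> \<le> (\<Sum>i<n. w i * (\<Sum>j<n. B $$ (i, j) * x j))"
        by (intro sum_mono mult_left_mono) (auto simp: sub w_nonneg)
      also have "\<dots> = (\<Sum>i<n. \<Sum>j<n. w i * B $$ (i, j) * x j)"
        by (simp add: sum_distrib_left mult.assoc)
      also have "\<dots> = (\<Sum>j<n. (\<Sum>i<n. w i * B $$ (i, j)) * x j)"
        by (subst sum.swap) (simp add: sum_distrib_right)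
      also have "\<dots> = (\<Sum>j<n. r ^ n * w j * x j)"
        by (intro sum.cong) (auto simp: left)
      also have "\<dots> = r ^ n * (\<Sum>i<n. w i * x i)"
        by (simp add: sum_distrib_left mult.assoc)
      finally show ?thesis
        using pos by simp
    qed
  qed (use n in auto)
  also have "r ^ n < (\<Sum>i<n. \<Sum>j<n. B $$ (i, j)) / real n"
  proof -
    have rows: "(\<Sum>j<n. B $$ (i, j)) = 1 - (1 - (real n - 1) * \<alpha>) * (1 + \<alpha>) ^ i" if "i < n" for i
      by (rule ccd_row_sum[OF rec that])
    have W: "0 < (\<Sum>i<n. w i)"
      by (rule sum_pos2[of _ 1]) (use n w_mono[of 0 1] w0 w_nonneg in auto)
    have "real n * (\<Sum>i<n. w i * (\<Sum>j<n. B $$ (i, j)))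
        < (\<Sum>i<n. w i) * (\<Sum>i<n. \<Sum>j<n. B $$ (i, j))"
    proof (rule Chebyshev_sum_strict[OF n])
      fix i j :: nat assume ij: "i < j" "j < n"
      show "w i < w j"
        by (rule w_mono[OF ij(1)])
      have "(1 + \<alpha>) ^ i < (1 + \<alpha>) ^ j"
        using ij \<alpha> by (intro power_strict_increasing) auto
      then show "(\<Sum>k<n. B $$ (j, k)) < (\<Sum>k<n. B $$ (i, k))"
        using ij \<alpha> by (simp add: rows)
    qed
    moreover have "(\<Sum>i<n. w i * (\<Sum>j<n. B $$ (i, j))) = r ^ n * (\<Sum>i<n. w i)"
    proof -
      have "(\<Sum>i<n. w i * (\<Sum>j<n. B $$ (i, j))) = (\<Sum>j<n. \<Sum>i<n. w i * B $$ (i, j))"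
        by (subst sum.swap) (simp add: sum_distrib_left)
      then show ?thesis
        by (simp add: left sum_distrib_left)
    qed
    ultimately have "(\<Sum>i<n. w i) * (real n * r ^ n)
        < (\<Sum>i<n. w i) * (\<Sum>i<n. \<Sum>j<n. B $$ (i, j))"
      by (simp add: mult_ac)
    then have "real n * r ^ n < (\<Sum>i<n. \<Sum>j<n. B $$ (i, j))"
      using W by simp
    then show ?thesis
      using n by (simp add: field_simps)
  qed
  finally show ?thesis .
qed

section \<open>Averaging over permutations\<close>

definition perm_mat :: "nat \<Rightarrow> (nat \<Rightarrow> nat) \<Rightarrow> real mat" where
  "perm_mat n p = mat n n (\<lambda>(i, j). if p j = i then 1 else 0)"

text \<open>
  Injectivity lets the average over the set of permutation matrices be taken over permutations.
\<close>

lemma inj_on_perm_mat: "inj_on (perm_mat n) {p. p permutes {0..<n}}"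
proof (rule inj_onI, rule ext)
  fix p q i
  assume p: "p \<in> {p. p permutes {0..<n}}" and q: "q \<in> {p. p permutes {0..<n}}"
    and eq: "perm_mat n p = perm_mat n q"
  show "p i = q i"
  proof (cases "i < n")
    case True
    then have pi: "p i < n"
      using p permutes_in_image[of p "{0..<n}" i] by simp
    then have "perm_mat n p $$ (p i, i) = 1"
      using True by (simp add: perm_mat_def)
    then have "perm_mat n q $$ (p i, i) = 1"
      using eq by simp
    then show ?thesis
      using True pi by (simp add: perm_mat_def split: if_splits)
  next
    case False
    then show ?thesis
      using p q by (simp add: permutes_def)
  qed
qed

lemma permutation_matrices_eq:
  "permutation_matrices n = perm_mat n ` {p. p permutes {0..<n}}"
  by (auto simp: permutation_matrices_def perm_mat_def)

text \<open>
  As \<open>P\<^sup>T\<close> fixes the all-ones vector, conjugation by \<open>P\<close> only permutes the row sums.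
\<close>

lemma conjugate_row_sum:
  fixes M :: "real mat"
  assumes M: "M \<in> carrier_mat n n" and p: "p permutes {0..<n}" and i: "i < n"
  shows "(\<Sum>j<n. (perm_mat n p * M * (perm_mat n p)\<^sup>T) $$ (i, j))
    = (\<Sum>k<n. if p k = i then (\<Sum>l<n. M $$ (k, l)) else 0)"
proof -
  have pl: "p l < n" if "l < n" for l
    using that permutes_in_image[OF p, of l] by simp
  have entry: "(perm_mat n p * M * (perm_mat n p)\<^sup>T) $$ (i, j)
      = (\<Sum>l<n. (\<Sum>k<n. if p k = i then M $$ (k, l) else 0) * (if p l = j then 1 else 0))"
    if j: "j < n" for j
    using i j M
    by (auto simp: perm_mat_def scalar_prod_def lessThan_atLeast0 intro!: sum.cong)
  have "(\<Sum>j<n. (perm_mat n p * M * (perm_mat n p)\<^sup>T) $$ (i, j))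
      = (\<Sum>l<n. \<Sum>j<n. (\<Sum>k<n. if p k = i then M $$ (k, l) else 0) * (if p l = j then 1 else 0))"
    by (rule trans[OF _ sum.swap]) (intro sum.cong refl entry, simp)
  also have "\<dots> = (\<Sum>l<n. \<Sum>k<n. if p k = i then M $$ (k, l) else 0)"
  proof (rule sum.cong[OF refl])
    fix l assume "l \<in> {..<n}"
    then have "p l < n"
      using pl by simp
    moreover have "(\<Sum>j<n. c * (if q = j then 1 else 0)) = c" if "q < n" for c :: real and q
      using that by (simp flip: sum_distrib_left)
    ultimately show "(\<Sum>j<n. (\<Sum>k<n. if p k = i then M $$ (k, l) else 0) * (if p l = j then 1 else 0))
        = (\<Sum>k<n. if p k = i then M $$ (k, l) else 0)"
      by blast
  qed
  also have "\<dots> = (\<Sum>k<n. if p k = i then (\<Sum>l<n. M $$ (k, l)) else 0)"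
    by (rule trans[OF sum.swap]) (auto intro!: sum.cong)
  finally show ?thesis .
qed

lemma conjugate_nonneg:
  fixes M :: "real mat"
  assumes M: "M \<in> carrier_mat n n" and "i < n" "j < n"
    and nonneg: "\<And>i j. i < n \<Longrightarrow> j < n \<Longrightarrow> 0 \<le> M $$ (i, j)"
  shows "0 \<le> (perm_mat n p * M * (perm_mat n p)\<^sup>T) $$ (i, j)"
  using assms by (auto simp: perm_mat_def scalar_prod_def intro!: sum_nonneg mult_nonneg_nonneg)

text \<open>
  The sum is the same at every position \<open>i\<close>, since composing with a transposition of two positions
  permutes the summands; and over all \<open>n\<close> positions together each permutation contributes the
  whole sum of \<open>f\<close>.
\<close>

lemma sum_permutations_at:
  fixes f :: "nat \<Rightarrow> real"
  assumes i: "i < n"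
  shows "real n * (\<Sum>p | p permutes {0..<n}. \<Sum>k<n. if p k = i then f k else 0)
    = fact n * (\<Sum>k<n. f k)"
proof -
  let ?S = "{p. p permutes {0..<n}}"
  define G where "G i = (\<Sum>p\<in>?S. \<Sum>k<n. if p k = i then f k else 0)" for i
  have same: "G j = G i" if j: "j < n" for j
  proof -
    let ?t = "transpose i j"
    have t: "?t permutes {0..<n}"
      using i j by (intro permutes_swap_id) auto
    show ?thesis
      unfolding G_def
    proof (rule sum.reindex_bij_witness[of _ "\<lambda>p. ?t \<circ> p" "\<lambda>p. ?t \<circ> p"])
      fix p assume "p \<in> ?S"
      have "?t (p k) = i \<longleftrightarrow> p k = j" for k
        by (auto simp: transpose_def)
      then show "(\<Sum>k<n. if (?t \<circ> p) k = i then f k else 0) = (\<Sum>k<n. if p k = j then f k else 0)"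
        by simp
    qed (auto simp: permutes_compose[OF _ t] comp_assoc[symmetric])
  qed
  have "real n * G i = (\<Sum>j<n. G j)"
    by (simp add: same)
  also have "\<dots> = (\<Sum>p\<in>?S. \<Sum>k<n. \<Sum>j<n. if p k = j then f k else 0)"
    unfolding G_def by (rule trans[OF sum.swap]) (rule sum.cong[OF refl sum.swap])
  also have "\<dots> = (\<Sum>p\<in>?S. \<Sum>k<n. f k)"
  proof (intro sum.cong refl)
    fix p k assume "p \<in> ?S" "k \<in> {..<n}"
    then have "p k < n"
      using permutes_in_image[of p "{0..<n}" k] by simp
    then show "(\<Sum>j<n. if p k = j then f k else 0) = f k"
      by simp
  qed
  also have "\<dots> = fact n * (\<Sum>k<n. f k)"
    by (simp add: card_permutations[OF refl])
  finally show ?thesis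
    by (simp add: G_def)
qed

lemma real_spectral_radius_B_RPCD:
  assumes n: "n > 0" and dim: "dim_row A = n" and Bc: "B_CCD A \<in> carrier_mat n n"
    and nonneg: "\<And>i j. i < n \<Longrightarrow> j < n \<Longrightarrow> 0 \<le> B_CCD A $$ (i, j)"
  shows "real_spectral_radius (B_RPCD A) = (\<Sum>i<n. \<Sum>j<n. B_CCD A $$ (i, j)) / real n"
proof (rule real_spectral_radius_const_row_sums)
  let ?S = "{p. p permutes {0..<n}}"
  let ?Q = "\<lambda>p. perm_mat n p * B_CCD A * (perm_mat n p)\<^sup>T"
  have entry: "B_RPCD A $$ (i, j) = (\<Sum>p\<in>?S. ?Q p $$ (i, j)) / fact n" if "i < n" "j < n" for i j
    using that dim
    by (simp add: B_RPCD_def permutation_matrices_eq sum.reindex[OF inj_on_perm_mat]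
        card_image[OF inj_on_perm_mat] card_permutations[OF refl])
  show "B_RPCD A \<in> carrier_mat n n"
    using dim by (simp add: B_RPCD_def)
  show "0 \<le> B_RPCD A $$ (i, j)" if "i < n" "j < n" for i j
    unfolding entry[OF that]
    by (intro divide_nonneg_nonneg sum_nonneg conjugate_nonneg[OF Bc that nonneg]) auto
  fix i assume i: "i < n"
  have "(\<Sum>j<n. B_RPCD A $$ (i, j)) = (\<Sum>j<n. \<Sum>p\<in>?S. ?Q p $$ (i, j)) / fact n"
    by (simp add: entry i sum_divide_distrib)
  also have "(\<Sum>j<n. \<Sum>p\<in>?S. ?Q p $$ (i, j))
      = (\<Sum>p\<in>?S. \<Sum>k<n. if p k = i then (\<Sum>l<n. B_CCD A $$ (k, l)) else 0)"
    by (rule trans[OF sum.swap]) (rule sum.cong[OF refl], simp add: conjugate_row_sum[OF Bc _ i])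
  also have "\<dots> = fact n * (\<Sum>k<n. \<Sum>l<n. B_CCD A $$ (k, l)) / real n"
    using sum_permutations_at[OF i, of "\<lambda>k. \<Sum>l<n. B_CCD A $$ (k, l)"] n
    by (simp add: field_simps)
  finally show "(\<Sum>j<n. B_RPCD A $$ (i, j)) = (\<Sum>i<n. \<Sum>j<n. B_CCD A $$ (i, j)) / real n"
    by simp
qed (rule n)

section \<open>Sampling with replacement\<close>

lemma real_spectral_radius_B_RCD:
  assumes n: "n > 0" and \<alpha>: "0 \<le> \<alpha>"
  shows "real_spectral_radius (B_RCD (hess n \<alpha>)) = 1 - (1 - (real n - 1) * \<alpha>) / real n"
proof (rule real_spectral_radius_const_row_sums)
  have dim: "dim_row (hess n \<alpha>) = n"
    using hess_carrier[of n \<alpha>] by auto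
  show "B_RCD (hess n \<alpha>) \<in> carrier_mat n n"
    using hess_carrier[of n \<alpha>] by (auto simp: B_RCD_def)
  have entry: "B_RCD (hess n \<alpha>) $$ (i, j)
      = \<alpha> / real n + (if i = j then 1 - (1 + \<alpha>) / real n else 0)" if "i < n" "j < n" for i j
    using that hess_carrier[of n \<alpha>] dim by (auto simp: B_RCD_def hess_entry field_simps)
  show "0 \<le> B_RCD (hess n \<alpha>) $$ (i, j)" if "i < n" "j < n" for i j
    using that n \<alpha> by (auto simp: entry field_simps)
  fix i assume i: "i < n"
  have "(\<Sum>j<n. B_RCD (hess n \<alpha>) $$ (i, j)) = \<alpha> + (1 - (1 + \<alpha>) / real n)"
    using i n by (simp add: entry sum.distrib)
  then show "(\<Sum>j<n. B_RCD (hess n \<alpha>) $$ (i, j)) = 1 - (1 - (real n - 1) * \<alpha>) / real n"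
    using n by (simp add: field_simps)
qed (rule n)

text \<open>
  At \<open>t = u\<close> the two sides would agree, because \<open>1 - u\<^sup>n = (1 - u) \<Sum>i<n. u\<^sup>i\<close>; the term \<open>i = 1\<close>
  makes the comparison strict.
\<close>

lemma one_minus_geometric_less_power:
  fixes u t :: real
  assumes n: "n \<ge> 2" and "0 \<le> u" "u < 1" "u < t"
  shows "1 - (1 - u) * (\<Sum>i<n. t ^ i) < u ^ n"
proof -
  have "(\<Sum>i<n. u ^ i) < (\<Sum>i<n. t ^ i)"
    by (rule sum_strict_mono_ex1) (use assms in \<open>auto intro!: power_mono bexI[of _ 1]\<close>)
  then have "(1 - u) * (\<Sum>i<n. u ^ i) < (1 - u) * (\<Sum>i<n. t ^ i)"
    using assms by simp
  then show ?thesis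
    using one_diff_power_eq[of u n] by simp
qed

theorem proposition4p4:
  fixes n :: nat and \<alpha> :: real and A :: "real mat"
  assumes "n \<ge> 2"
    and "\<alpha> \<in> {0<..<1 / (real n - 1)}"
    and "A = hess n \<alpha>"
  shows "real_spectral_radius (B_CCD A) < real_spectral_radius (B_RPCD A) \<and>
    real_spectral_radius (B_RPCD A) < real_spectral_radius (B_RCD A) ^ n"
proof -
  note A = assms(3)
  have n: "n \<ge> 2" "n > 0"
    using assms(1) by auto
  have \<alpha>: "0 < \<alpha>" "(real n - 1) * \<alpha> < 1"
    using assms(2) n by (simp_all add: pos_less_divide_eq mult.commute)
  have dim: "dim_row A = n"
    using hess_carrier[of n \<alpha>] A by auto
  have Bc: "B_CCD A \<in> carrier_mat n n"
    using B_CCD_recursion(1) A by simp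
  note rec = B_CCD_recursion(2)[of _ n _ \<alpha>, folded A]
  have nonneg: "0 \<le> B_CCD A $$ (i, j)" if "i < n" "j < n" for i j
    using B_CCD_nonneg that \<alpha> A by simp
  note rpcd = real_spectral_radius_B_RPCD[OF n(2) dim Bc nonneg]
  define u where "u = 1 - (1 - (real n - 1) * \<alpha>) / real n"
  have "0 \<le> (real n - 1) * \<alpha>"
    using n \<alpha> by simp
  then have "1 - (real n - 1) * \<alpha> \<le> real n"
    using n by linarith
  then have u: "0 \<le> u" "u < 1"
    using n \<alpha> by (auto simp: u_def divide_le_eq)
  have "(\<Sum>i<n. \<Sum>j<n. B_CCD A $$ (i, j))
      = (\<Sum>i<n. 1 - (1 - (real n - 1) * \<alpha>) * (1 + \<alpha>) ^ i)"
    by (intro sum.cong refl ccd_row_sum rec) auto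
  also have "\<dots> = real n - (1 - (real n - 1) * \<alpha>) * (\<Sum>i<n. (1 + \<alpha>) ^ i)"
    by (simp add: sum_subtractf sum_distrib_left)
  finally have total: "(\<Sum>i<n. \<Sum>j<n. B_CCD A $$ (i, j))
      = real n - (1 - (real n - 1) * \<alpha>) * (\<Sum>i<n. (1 + \<alpha>) ^ i)" .
  have "(real n - a * x) / real n = 1 - a / real n * x" for a x
    using n by (simp add: diff_divide_distrib)
  then have "real_spectral_radius (B_RPCD A) = 1 - (1 - u) * (\<Sum>i<n. (1 + \<alpha>) ^ i)"
    by (simp add: rpcd total u_def)
  also have "\<dots> < u ^ n"
    by (rule one_minus_geometric_less_power) (use n u \<alpha> in auto)
  also have "u = real_spectral_radius (B_RCD A)"
    using real_spectral_radius_B_RCD[of n \<alpha>] n \<alpha> A by (simp add: u_def)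
  finally show ?thesis
    using real_spectral_radius_B_CCD_less[OF n(1) \<alpha>] A rpcd by simp
qed

end
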